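(* Let $K$ be a nonempty closed, bounded, convex subset of a Hilbert space $H$ and let $T: K \to K$ be a perimetric nonexpansive mapping. Then $T$ has a fixed point.
   Context: For a subset $K$ of a normed linear space $(X,\|\cdot\|)$ (here $X = H$ with the norm induced by its inner product), a mapping $T: K \to K$ is called a perimetric nonexpansive mapping if for all pairwise distinct points $x,y,z \in K$, $$\|Tx-Ty\| + \|Ty-Tz\| + \|Tz-Tx\| \le \|x-y\| + \|y-z\| + \|z-x\|.$$ A fixed point of $T$ is a point $x \in K$ with $Tx = x$. *)

theory Defs
  imports "HOL-Analysis.Analysis"
begin

text \<open>
  A mapping \<open>T : K \<rightarrow> K\<close> is represented by a total function on the ambient type that sends \<open>K\<close>
  into itself; its values outside \<open>K\<close> are irrelevant.
\<close>

definition perimetric_nonexpansive_on ::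
    "'a::real_normed_vector set \<Rightarrow> ('a \<Rightarrow> 'a) \<Rightarrow> bool" where
  "perimetric_nonexpansive_on K T \<longleftrightarrow>
     T ` K \<subseteq> K \<and>
     (\<forall>x\<in>K. \<forall>y\<in>K. \<forall>z\<in>K. x \<noteq> y \<and> y \<noteq> z \<and> z \<noteq> x \<longrightarrow>
        norm (T x - T y) + norm (T y - T z) + norm (T z - T x)
          \<le> norm (x - y) + norm (y - z) + norm (z - x))"

end

theory Submission
  imports Defs
begin

text \<open>
  On a convex set a perimetric nonexpansive map is nonexpansive: for \<open>z\<close> the midpoint of \<open>x\<close> and
  \<open>y\<close>, the triangle inequality bounds the image perimeter below by \<open>2 * norm (T x - T y)\<close>, while
  the perimeter of the degenerate triangle is \<open>2 * norm (x - y)\<close>.  Fixed points of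
  nonexpansive maps are then obtained by Browder's approximation: fix \<open>u \<in> K\<close>, let \<open>x n\<close> be the
  fixed point of the contraction \<open>x \<mapsto> u + (T x - u) / (1 + a n)\<close> with \<open>a n\<close> decreasing to \<open>0\<close>.
  Nonexpansiveness makes \<open>norm (x n - u)\<close> increasing and bounds \<open>(norm (x m - x n))\<^sup>2\<close> by the
  increment of its square, so boundedness alone gives norm convergence, without any weak
  compactness.
\<close>

lemma perimetric_nonexpansive_on_convex_imp_lipschitz:
  fixes T :: "'a::real_normed_vector \<Rightarrow> 'a"
  assumes "convex K" and T: "perimetric_nonexpansive_on K T" and xy: "x \<in> K" "y \<in> K"
  shows "norm (T x - T y) \<le> norm (x - y)"
proof (cases "x = y")
  case False
  define z where "z = midpoint x y"
  have "z \<in> K"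
    using assms(1) xy unfolding z_def midpoint_def
    by (simp add: scaleR_right_distrib convex_def)
  \<comment> \<open>The perimeter condition speaks only of pairwise distinct triples.\<close>
  moreover have "z \<noteq> x" "y \<noteq> z"
    using False midpoint_eq_endpoint[of x y] unfolding z_def by metis+
  ultimately have "norm (T x - T y) + norm (T y - T z) + norm (T z - T x)
      \<le> norm (x - y) + norm (y - z) + norm (z - x)"
    using T xy False unfolding perimetric_nonexpansive_on_def by blast
  moreover have "norm (y - z) + norm (z - x) = norm (x - y)"
    using dist_midpoint[of x y] by (simp add: z_def dist_norm norm_minus_commute)
  moreover have "norm (T x - T y) \<le> norm (T y - T z) + norm (T z - T x)"
    using norm_triangle_ineq[of "T y - T z" "T z - T x"] by (simp add: norm_minus_commute)
  ultimately show ?thesis by linarith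
qed simp

text \<open>With \<open>w = a x - b y\<close> the hypothesis reads
  \<open>norm ((x - y) + w) \<le> norm (x - y)\<close>; expanding squares forces
  \<open>inner (x - y) w \<le> 0\<close>. It serves with \<open>x\<close>, \<open>y\<close> the
  displacements from \<open>u\<close> of a later and an earlier approximate fixed point.\<close>

lemma norm_diff_le_of_norm_scaled_diff_le:
  fixes x y :: "'a::real_inner"
  assumes "0 < a" "a \<le> b"
    and le: "norm ((1 + a) *\<^sub>R x - (1 + b) *\<^sub>R y) \<le> norm (x - y)"
  shows "(norm (x - y))\<^sup>2 \<le> (norm x)\<^sup>2 - (norm y)\<^sup>2"
proof -
  define w where "w = a *\<^sub>R x - b *\<^sub>R y"
  have "(norm ((x - y) + w))\<^sup>2 \<le> (norm (x - y))\<^sup>2"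
    using le by (intro power_mono) (simp_all add: w_def algebra_simps)
  then have "2 * inner (x - y) w + inner w w \<le> 0"
    by (simp add: power2_norm_eq_inner inner_add_left inner_add_right inner_commute)
  then have "inner (x - y) w \<le> 0"
    using inner_ge_zero[of w] by linarith
  \<comment> \<open>Polarisation: twice \<open>inner (x - y) w\<close> is the left side minus the
    right side.\<close>
  then have *: "(a + b) * (norm (x - y))\<^sup>2 \<le> (b - a) * ((norm x)\<^sup>2 - (norm y)\<^sup>2)"
    by (simp add: w_def power2_norm_eq_inner inner_diff_left inner_diff_right inner_commute
        algebra_simps)
  show ?thesis
  proof (cases "a = b")
    case True
    with * assms show ?thesis
      by (auto simp: mult_le_0_iff)
  next
    case False
    \<comment> \<open>Since \<open>b - a > 0\<close>, \<open>*\<close> makes the difference of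
      squares nonnegative, so the factor \<open>b - a\<close> may be enlarged to
      \<open>a + b\<close> and cancelled.\<close>
    have "0 \<le> (a + b) * (norm (x - y))\<^sup>2"
      using assms by simp
    with * False \<open>a \<le> b\<close> have "0 \<le> (norm x)\<^sup>2 - (norm y)\<^sup>2"
      by (smt (verit) zero_le_mult_iff)
    then have "(b - a) * ((norm x)\<^sup>2 - (norm y)\<^sup>2) \<le> (a + b) * ((norm x)\<^sup>2 - (norm y)\<^sup>2)"
      using assms by (intro mult_right_mono) auto
    with * have "(a + b) * (norm (x - y))\<^sup>2 \<le> (a + b) * ((norm x)\<^sup>2 - (norm y)\<^sup>2)"
      by linarith
    then show ?thesis
      using assms by simp
  qed
qed

text \<open>The real sequence \<open>r\<close> is increasing and bounded, hence Cauchy, and its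
  increments control those of \<open>y\<close>.\<close>

lemma Cauchy_of_norm_diff_le_increment:
  fixes y :: "nat \<Rightarrow> 'a::real_normed_vector"
  assumes incr: "\<And>m n. m \<le> n \<Longrightarrow> (norm (y n - y m))\<^sup>2 \<le> r n - r m"
    and bdd: "\<And>n. r n \<le> B"
  shows "Cauchy y"
proof (rule metric_CauchyI)
  have "incseq r"
    unfolding incseq_def using incr by (metis diff_ge_0_iff_ge order_trans zero_le_power2)
  then have "Cauchy r"
    using bdd by (metis incseq_convergent LIMSEQ_imp_Cauchy)
  fix e :: real
  assume "0 < e"
  then obtain N where N: "\<And>m n. N \<le> m \<Longrightarrow> N \<le> n \<Longrightarrow> dist (r m) (r n) < e\<^sup>2"
    using metric_CauchyD[OF \<open>Cauchy r\<close>, of "e\<^sup>2"] by auto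
  have close: "dist (y n) (y m) < e" if "N \<le> m" "m \<le> n" for m n
  proof (rule power_less_imp_less_base)
    show "(dist (y n) (y m))\<^sup>2 < e\<^sup>2"
      using incr[OF that(2)] N[of m n] that by (auto simp: dist_norm)
  qed (use \<open>0 < e\<close> in simp)
  show "\<exists>N. \<forall>m\<ge>N. \<forall>n\<ge>N. dist (y m) (y n) < e"
    using close by (metis dist_commute nle_le)
qed

lemma nonexpansive_fixpoint:
  fixes K :: "'a::{real_inner, complete_space} set"
  assumes "u \<in> K" "closed K" "bounded K" "convex K" "T ` K \<subseteq> K"
    and lip: "\<And>x y. x \<in> K \<Longrightarrow> y \<in> K \<Longrightarrow> norm (T x - T y) \<le> norm (x - y)"
  shows "\<exists>x\<in>K. T x = x"
proof -
  define a :: "nat \<Rightarrow> real" where "a n = inverse (real (Suc n))" for n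
  have a_pos: "0 < a n" for n
    by (simp add: a_def)
  have a_antimono: "a n \<le> a m" if "m \<le> n" for m n
    using that by (simp add: a_def field_simps)
  have "\<exists>x\<in>K. T x - u = (1 + a n) *\<^sub>R (x - u)" for n
  proof -
    \<comment> \<open>The approximating map is the convex combination of \<open>u\<close> and
      \<open>T x\<close> with weight \<open>t\<close> on \<open>T x\<close>: it preserves
      \<open>K\<close> and contracts by \<open>t < 1\<close>.\<close>
    define t where "t = inverse (1 + a n)"
    have t: "0 < t" "t < 1"
      using a_pos[of n] by (auto simp: t_def field_simps)
    have "\<exists>!x\<in>K. (1 - t) *\<^sub>R u + t *\<^sub>R T x = x"
    proof (rule Banach_fix[where c = t])
      show "complete K"
        using \<open>closed K\<close> by (simp add: complete_eq_closed)
      show "(\<lambda>x. (1 - t) *\<^sub>R u + t *\<^sub>R T x) ` K \<subseteq> K"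
        using t assms(1,4,5) by (auto intro!: convexD)
    qed (use t lip assms(1) in
        \<open>auto simp: dist_norm simp flip: scaleR_diff_right intro!: mult_left_mono\<close>)
    then obtain x where x: "x \<in> K" "(1 - t) *\<^sub>R u + t *\<^sub>R T x = x"
      by blast
    then have "x - u = t *\<^sub>R (T x - u)"
      by (simp add: algebra_simps)
    moreover have "(1 + a n) * t = 1"
      using a_pos[of n] by (simp add: t_def)
    ultimately have "T x - u = (1 + a n) *\<^sub>R (x - u)"
      by simp
    with x show ?thesis by blast
  qed
  then obtain x where x: "\<And>n. x n \<in> K" "\<And>n. T (x n) - u = (1 + a n) *\<^sub>R (x n - u)"
    by metis
  obtain B where B: "\<And>z. z \<in> K \<Longrightarrow> norm (z - u) \<le> B"
    using \<open>bounded K\<close> unfolding bounded_any_center[of K u] dist_norm by (metis norm_minus_commute)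
  have "Cauchy x"
  proof (rule Cauchy_of_norm_diff_le_increment)
    show "(norm (x n - x m))\<^sup>2 \<le> (norm (x n - u))\<^sup>2 - (norm (x m - u))\<^sup>2" if "m \<le> n" for m n
    proof -
      \<comment> \<open>The scaled displacements are \<open>T (x n) - u\<close> and
        \<open>T (x m) - u\<close>, so \<open>u\<close> cancels and nonexpansiveness
        applies.\<close>
      have "norm ((1 + a n) *\<^sub>R (x n - u) - (1 + a m) *\<^sub>R (x m - u))
          \<le> norm ((x n - u) - (x m - u))"
        using lip[OF x(1) x(1), of n m] unfolding x(2)[symmetric] by simp
      from norm_diff_le_of_norm_scaled_diff_le[OF a_pos a_antimono[OF that] this]
      show ?thesis by simp
    qed
    show "(norm (x n - u))\<^sup>2 \<le> B\<^sup>2" for n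
      using B[OF x(1)] by (intro power_mono) auto
  qed
  then obtain p where p: "x \<longlonglongrightarrow> p"
    using Cauchy_convergent_iff convergent_def by blast
  then have "p \<in> K"
    using \<open>closed K\<close> x(1) closed_sequentially by blast
  \<comment> \<open>The fixed-point equation gives \<open>T (x n)\<close> the limit
    \<open>p\<close>; continuity of \<open>T\<close> on \<open>K\<close> gives it the limit
    \<open>T p\<close>.\<close>
  have "(\<lambda>n. u + (1 + a n) *\<^sub>R (x n - u)) \<longlonglongrightarrow> u + (1 + 0) *\<^sub>R (p - u)"
    using LIMSEQ_inverse_real_of_nat unfolding a_def by (intro tendsto_intros p)
  then have "(\<lambda>n. T (x n)) \<longlonglongrightarrow> p"
    by (simp flip: x(2))
  moreover have "(\<lambda>n. T (x n)) \<longlonglongrightarrow> T p"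
  proof (rule metric_tendsto_imp_tendsto[OF p])
    show "\<forall>\<^sub>F n in sequentially. dist (T (x n)) (T p) \<le> dist (x n) p"
      using lip x(1) \<open>p \<in> K\<close> by (simp add: dist_norm)
  qed
  ultimately show ?thesis
    using LIMSEQ_unique \<open>p \<in> K\<close> by blast
qed

theorem theorem3p5:
  fixes K :: "'a::{real_inner, complete_space} set"
    and T :: "'a \<Rightarrow> 'a"
  assumes "K \<noteq> {}"
    and "closed K"
    and "bounded K"
    and "convex K"
    and "perimetric_nonexpansive_on K T"
  shows "\<exists>x\<in>K. T x = x"
proof -
  obtain u where "u \<in> K"
    using assms(1) by blast
  moreover have "T ` K \<subseteq> K"
    using assms(5) by (simp add: perimetric_nonexpansive_on_def)
  ultimately show ?thesis
    using assms(2-4) perimetric_nonexpansive_on_convex_imp_lipschitz[OF assms(4,5)]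
    by (intro nonexpansive_fixpoint)
qed

end
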